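(* Let $v \in \mathbb V$, let $\xi^\dagger$ be a $\|\cdot\|_{1,\mathbf w}$-minimizing solution of the equation $(\mathbf K\circ\mathbf D)(\xi) = v$, let $\rho > \|\xi^\dagger\|_{\ell^2(\Lambda)}$, and let $\alpha \colon (0,\infty)\to(0,\infty)$ be such that $$\lim_{\delta\to 0}\alpha(\delta) = \lim_{\delta\to 0} \frac{\Delta_\rho(\alpha(\delta))^2}{\alpha(\delta)} = \lim_{\delta\to 0}\frac{\delta^2}{\alpha(\delta)} = 0 .$$ Moreover, let $(\delta_k)_{k\in\mathbb N}\in(0,\infty)^{\mathbb N}$ and $(v_k)_{k\in\mathbb N}\in\mathbb V^{\mathbb N}$ satisfy $\delta_k\to 0$ and $\|v - v_k\|\le\delta_k$, and choose $\xi_k\in\arg\min \mathcal S_{\alpha(\delta_k),v_k}$ for each $k$. Then the following hold: (a) $(\xi_k)_{k\in\mathbb N}$ has a convergent subsequence. (b) The limit of every convergent subsequence $(\xi_{k(n)})_{n\in\mathbb N}$ is a $\|\cdot\|_{1,\mathbf w}$-minimizing solution of $(\mathbf K\circ\mathbf D)(\xi)=v$. (c) If the $\|\cdot\|_{1,\mathbf w}$-minimizing solution of $(\mathbf K\circ\mathbf D)(\xi)=v$ is unique, then $\xi_k\to\xi^\dagger$.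
   Context: Setting and standing assumptions: $\mathbb U$ and $\mathbb V$ are Hilbert spaces; $\mathbf K \colon \mathbb U \to \mathbb V$ is linear and bounded; $\Lambda$ is an at most countable set; $\mathbf D \colon \ell^2(\Lambda)\to\mathbb U$ and $\mathbf D_\alpha \colon \ell^2(\Lambda) \to \mathbb U$ for $\alpha>0$ are given (possibly non-linear) maps; for every $\alpha>0$ the map $\mathbf D_\alpha$ is weakly sequentially continuous; $\mathbf w = (w_\lambda)_{\lambda\in\Lambda} \in (0,\infty)^\Lambda$ satisfies $\inf_{\lambda\in\Lambda} w_\lambda > 0$. Moreover, for every $\rho>0$, $$\Delta_\rho(\alpha) = \sup_{\|\xi\|_{\ell^2(\Lambda)}\le\rho}\|\mathbf D_\alpha(\xi)-\mathbf D(\xi)\|_{\mathbb U} \to 0 \quad\text{as } \alpha\to 0.$$ The weighted $\ell^1$-norm is $\|\xi\|_{1,\mathbf w} = \sum_{\lambda\in\Lambda} w_\lambda |\xi_\lambda| \in [0,\infty]$ for $\xi\in\ell^2(\Lambda)$. For $\alpha>0$ and $v \in \mathbb V$ the deep synthesis functional is $$\mathcal S_{\alpha,v}(\xi) = \|(\mathbf K\circ \mathbf D_\alpha)(\xi) - v\|_{\mathbb V}^2 + \alpha \|\xi\|_{1,\mathbf w},\qquad \xi\in\ell^2(\Lambda).$$ A $\|\cdot\|_{1,\mathbf w}$-minimizing solution of $(\mathbf K\circ\mathbf D)(\xi)=v$ is an element of $\arg\min\{\|\xi\|_{1,\mathbf w} \mid (\mathbf K\circ\mathbf D)(\xi)=v\}$,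 with the convention that the minimal value is finite. Convergence in $\ell^2(\Lambda)$ is norm convergence. *)

theory Defs
  imports "HOL-Analysis.Analysis"
begin

text \<open>
  The scalars have a type \<open>'k\<close> of sort \<open>{real_normed_field, euclidean_space}\<close>, which has both
  \<open>real\<close> and \<open>complex\<close> as instances.  Hilbert spaces are types of sort
  \<open>{real_inner, complete_space}\<close>; a complex Hilbert space is covered through its underlying real
  Hilbert space, with inner product the real part of the complex one, which has the same norm and
  the same weakly convergent sequences.

  The space of square-summable families on \<open>\<Lambda>\<close> is a set of functions on the ambient index type.
  They vanish outside \<open>\<Lambda>\<close>, so that each family is represented by exactly one function.
\<close>

definition ell2 :: "'l set \<Rightarrow> ('l \<Rightarrow> 'k::{real_normed_field, euclidean_space}) set" where
  "ell2 \<Lambda> = {\<xi>. (\<forall>l. l \<notin> \<Lambda> \<longrightarrow> \<xi> l = 0) \<and> (\<lambda>l. (norm (\<xi> l))\<^sup>2) summable_on \<Lambda>}"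

definition ell2_norm :: "'l set \<Rightarrow> ('l \<Rightarrow> 'k::{real_normed_field, euclidean_space}) \<Rightarrow> real" where
  "ell2_norm \<Lambda> \<xi> = sqrt (\<Sum>\<^sub>\<infinity>l\<in>\<Lambda>. (norm (\<xi> l))\<^sup>2)"

definition ell2_inner ::
    "'l set \<Rightarrow> ('l \<Rightarrow> 'k::{real_normed_field, euclidean_space}) \<Rightarrow> ('l \<Rightarrow> 'k) \<Rightarrow> real" where
  "ell2_inner \<Lambda> \<xi> \<eta> = (\<Sum>\<^sub>\<infinity>l\<in>\<Lambda>. \<xi> l \<bullet> \<eta> l)"

definition ell2_tendsto ::
    "'l set \<Rightarrow> (nat \<Rightarrow> 'l \<Rightarrow> 'k::{real_normed_field, euclidean_space}) \<Rightarrow> ('l \<Rightarrow> 'k) \<Rightarrow> bool" where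
  "ell2_tendsto \<Lambda> x a \<longleftrightarrow>
     (\<forall>n. x n \<in> ell2 \<Lambda>) \<and> a \<in> ell2 \<Lambda> \<and> (\<lambda>n. ell2_norm \<Lambda> (\<lambda>l. x n l - a l)) \<longlonglongrightarrow> 0"

definition ell2_weakly_tendsto ::
    "'l set \<Rightarrow> (nat \<Rightarrow> 'l \<Rightarrow> 'k::{real_normed_field, euclidean_space}) \<Rightarrow> ('l \<Rightarrow> 'k) \<Rightarrow> bool" where
  "ell2_weakly_tendsto \<Lambda> x a \<longleftrightarrow>
     (\<forall>n. x n \<in> ell2 \<Lambda>) \<and> a \<in> ell2 \<Lambda> \<and>
     (\<forall>y\<in>ell2 \<Lambda>. (\<lambda>n. ell2_inner \<Lambda> (x n) y) \<longlonglongrightarrow> ell2_inner \<Lambda> a y)"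

definition weakly_tendsto :: "(nat \<Rightarrow> 'u::real_inner) \<Rightarrow> 'u \<Rightarrow> bool" where
  "weakly_tendsto x a \<longleftrightarrow> (\<forall>y. (\<lambda>n. x n \<bullet> y) \<longlonglongrightarrow> a \<bullet> y)"

definition weakly_seq_continuous ::
    "'l set \<Rightarrow> (('l \<Rightarrow> 'k::{real_normed_field, euclidean_space}) \<Rightarrow> 'u::real_inner) \<Rightarrow> bool" where
  "weakly_seq_continuous \<Lambda> F \<longleftrightarrow>
     (\<forall>x a. ell2_weakly_tendsto \<Lambda> x a \<longrightarrow> weakly_tendsto (\<lambda>n. F (x n)) (F a))"

definition weighted_l1_norm ::
    "'l set \<Rightarrow> ('l \<Rightarrow> real) \<Rightarrow> ('l \<Rightarrow> 'k::{real_normed_field, euclidean_space}) \<Rightarrow> ennreal" where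
  "weighted_l1_norm \<Lambda> w \<xi> = (\<Sum>\<^sub>\<infinity>l\<in>\<Lambda>. ennreal (w l * norm (\<xi> l)))"

text \<open>
  The family \<open>D\<^sub>\<alpha>\<close> is the curried function \<open>Da\<close>, whose values at nonpositive \<open>\<alpha>\<close> play no role.
  The supremum may be infinite for individual \<open>\<alpha>\<close>, hence the type \<open>ennreal\<close>.
\<close>

definition Delta ::
    "'l set \<Rightarrow> (('l \<Rightarrow> 'k::{real_normed_field, euclidean_space}) \<Rightarrow> 'u::real_normed_vector)
      \<Rightarrow> (real \<Rightarrow> ('l \<Rightarrow> 'k) \<Rightarrow> 'u) \<Rightarrow> real \<Rightarrow> real \<Rightarrow> ennreal" where
  "Delta \<Lambda> D Da \<rho> \<alpha> =
     (SUP \<xi>\<in>{\<xi> \<in> ell2 \<Lambda>. ell2_norm \<Lambda> \<xi> \<le> \<rho>}. ennreal (norm (Da \<alpha> \<xi> - D \<xi>)))"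

definition synthesis_functional ::
    "'l set \<Rightarrow> ('l \<Rightarrow> real) \<Rightarrow> ('u \<Rightarrow> 'v::real_normed_vector)
      \<Rightarrow> (real \<Rightarrow> ('l \<Rightarrow> 'k::{real_normed_field, euclidean_space}) \<Rightarrow> 'u)
      \<Rightarrow> real \<Rightarrow> 'v \<Rightarrow> ('l \<Rightarrow> 'k) \<Rightarrow> ennreal" where
  "synthesis_functional \<Lambda> w K Da \<alpha> v \<xi> =
     ennreal ((norm ((K \<circ> Da \<alpha>) \<xi> - v))\<^sup>2) + ennreal \<alpha> * weighted_l1_norm \<Lambda> w \<xi>"

definition minimizing_solution ::
    "'l set \<Rightarrow> ('l \<Rightarrow> real) \<Rightarrow> (('l \<Rightarrow> 'k::{real_normed_field, euclidean_space}) \<Rightarrow> 'v)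
      \<Rightarrow> 'v \<Rightarrow> ('l \<Rightarrow> 'k) \<Rightarrow> bool" where
  "minimizing_solution \<Lambda> w F v \<xi> \<longleftrightarrow>
     is_arg_min (weighted_l1_norm \<Lambda> w) (\<lambda>\<eta>. \<eta> \<in> ell2 \<Lambda> \<and> F \<eta> = v) \<xi> \<and>
     weighted_l1_norm \<Lambda> w \<xi> < \<infinity>"

end

theory Submission
  imports Defs "HOL-Complex_Analysis.Great_Picard"
begin

text \<open>
  Let \<open>M\<close> be the minimal weighted l1-norm of a solution and \<open>B\<close> a bound for \<open>K\<close>.  Comparing the
  functional at its minimizer \<open>\<xi> k\<close> with its value at the exact solution \<open>\<xi>\<^sub>d\<close>, and writing
  \<open>a = \<alpha> (\<delta> k)\<close>, gives two estimates.  First, the weighted l1-norm of \<open>\<xi> k\<close> is at most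
  \<open>M + (B \<Delta>\<^sub>\<rho>(a) + \<delta> k)\<^sup>2 / a\<close>, and by the parameter choice this tends to \<open>M\<close>.  Second, the residual
  of \<open>\<xi> k\<close> tends to zero.  As the weights are bounded below, the \<open>\<xi> k\<close> stay in a ball of \<open>\<ell>\<^sup>2\<close>, on
  which \<open>Da a\<close> converges to \<open>D\<close> uniformly; so \<open>K (D (\<xi> k))\<close> tends to \<open>v\<close> in norm.

  The analytic part is \<open>minimizing_solution_limit\<close>: every coordinatewise limit \<open>\<eta>\<close> of a sequence with
  these properties is a minimizing solution, and is also its limit in norm.
  By lower semicontinuity the weighted l1-norm of \<open>\<eta>\<close> is at most \<open>M\<close>
  (\<open>weighted_l1_norm_lower_semicontinuous\<close>).  Coordinatewise convergence with bounded weighted l1-norms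
  is weak convergence in \<open>\<ell>\<^sup>2\<close> (\<open>ell2_weakly_tendsto_of_pointwise\<close>).  The operator \<open>D\<close> inherits weak
  sequential continuity on balls from the \<open>Da a\<close> (\<open>weakly_tendsto_of_Delta_tendsto\<close>), and \<open>K\<close> is
  weakly continuous by the Riesz representation theorem, so \<open>\<eta>\<close> solves the equation.  Its norm is
  then equal to \<open>M\<close> by minimality, and coordinatewise convergence together with convergence of the
  norms gives convergence in norm (\<open>weighted_l1_norm_diff_small\<close>).

  A diagonal argument over the countable index set gives a coordinatewise convergent subsequence of
  every subsequence of \<open>\<xi>\<close>, which yields the existence of a convergent subsequence and, if
  the minimizing solution is unique, convergence of the whole sequence.  Since norm convergence
  implies coordinatewise convergence, every norm limit of a subsequence is a minimizing solution.
\<close>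

section \<open>Weak convergence in Hilbert spaces\<close>

text \<open>
  The representing vector minimizes the strictly convex energy \<open>\<lambda>x. x \<bullet> x - 2 * f x\<close>; minimizing
  sequences are Cauchy by the parallelogram identity.
\<close>

lemma riesz_representation:
  fixes f :: "'u::{real_inner, complete_space} \<Rightarrow> real"
  assumes "bounded_linear f"
  obtains z where "\<And>y. f y = z \<bullet> y"
proof -
  interpret f: bounded_linear f by fact
  define q where "q x = x \<bullet> x - 2 * f x" for x
  obtain B where B: "\<And>x. norm (f x) \<le> norm x * B"
    using f.bounded by blast
  have lower: "- B\<^sup>2 \<le> q x" for x
  proof -
    have "f x \<le> norm x * B" using B[of x] by simp
    moreover have "0 \<le> (norm x - B)\<^sup>2" by simp
    ultimately show ?thesis
      unfolding q_def by (simp add: power2_diff power2_norm_eq_inner)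
  qed
  then have bdd: "bdd_below (range q)" by (intro bdd_belowI) auto
  define I where "I = Inf (range q)"
  have I_le: "I \<le> q x" for x
    unfolding I_def using bdd by (auto intro: cInf_lower)
  have "\<exists>x. q x < I + inverse (real (Suc n))" for n
  proof -
    have "Inf (range q) < I + inverse (real (Suc n))" by (simp add: I_def)
    then show ?thesis using bdd by (subst (asm) cInf_less_iff) auto
  qed
  then obtain X where X: "\<And>n. q (X n) < I + inverse (real (Suc n))" by metis
  have parallelogram: "(norm (x - y))\<^sup>2 = 2 * (q x + q y - 2 * q ((1/2) *\<^sub>R (x + y)))" for x y
    by (simp add: q_def f.scaleR f.add power2_norm_eq_inner inner_simps inner_commute algebra_simps)
  have close: "(norm (X m - X n))\<^sup>2 < 4 * inverse (real (Suc N))" if "m \<ge> N" "n \<ge> N" for m n N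
  proof -
    have "inverse (real (Suc m)) \<le> inverse (real (Suc N))"
      "inverse (real (Suc n)) \<le> inverse (real (Suc N))"
      using that by (auto intro!: le_imp_inverse_le)
    moreover have "2 * (a + b - 2 * c) < 4 * u"
      if "a < I + p" "b < I + s" "I \<le> c" "p \<le> u" "s \<le> u" for a b c p s u :: real
      using that by argo
    ultimately show ?thesis
      unfolding parallelogram using X I_le by blast
  qed
  have "Cauchy X"
  proof (rule metric_CauchyI)
    fix e :: real assume e: "e > 0"
    obtain N where N: "inverse (real (Suc N)) < e\<^sup>2 / 4"
      using reals_Archimedean[of "e\<^sup>2 / 4"] e by auto
    have "dist (X m) (X n) < e" if "m \<ge> N" "n \<ge> N" for m n
    proof -
      have "(norm (X m - X n))\<^sup>2 < e\<^sup>2" using close[OF that] N by simp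
      then show ?thesis unfolding dist_norm by (rule power2_less_imp_less) (use e in simp)
    qed
    then show "\<exists>M. \<forall>m\<ge>M. \<forall>n\<ge>M. dist (X m) (X n) < e" by blast
  qed
  then obtain z where z: "X \<longlonglongrightarrow> z"
    by (auto simp: Cauchy_convergent_iff convergent_def)
  have "(\<lambda>n. q (X n)) \<longlonglongrightarrow> q z"
    unfolding q_def by (intro tendsto_intros z f.tendsto)
  moreover have "(\<lambda>n. I + inverse (real (Suc n))) \<longlonglongrightarrow> I + 0"
    by (intro tendsto_intros LIMSEQ_inverse_real_of_nat)
  ultimately have "q z \<le> I + 0"
    by (rule LIMSEQ_le) (use X in \<open>auto intro: less_imp_le\<close>)
  then have min: "q z \<le> q x" for x using I_le[of x] by simp
  have "f y = z \<bullet> y" for y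
  proof (rule ccontr)
    assume "f y \<noteq> z \<bullet> y"
    define g where "g = z \<bullet> y - f y"
    define Y where "Y = y \<bullet> y"
    have Y: "Y \<ge> 0" and g: "g \<noteq> 0"
      using \<open>f y \<noteq> z \<bullet> y\<close> by (auto simp: g_def Y_def)
    have expand: "q (z + t *\<^sub>R y) = q z + 2 * t * g + t\<^sup>2 * Y" for t
      by (simp add: q_def g_def Y_def f.scaleR f.add inner_simps inner_commute algebra_simps
          power2_eq_square)
    \<comment> \<open>A step of this size against the gradient would strictly decrease \<open>q\<close>.\<close>
    define t where "t = - g / (Y + 1)"
    have tY: "t * (Y + 1) = - g" using Y by (simp add: t_def)
    have "0 \<le> 2 * t * g + t\<^sup>2 * Y" using min[of "z + t *\<^sub>R y"] expand[of t] by simp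
    also have "\<dots> = t * g - t\<^sup>2"
    proof -
      have "t\<^sup>2 * Y = t * (t * (Y + 1)) - t\<^sup>2" by (simp add: power2_eq_square algebra_simps)
      then show ?thesis by (simp add: tY)
    qed
    also have "t * g = - g\<^sup>2 / (Y + 1)" by (simp add: t_def power2_eq_square)
    finally have "g\<^sup>2 / (Y + 1) + t\<^sup>2 \<le> 0" by simp
    moreover have "g\<^sup>2 / (Y + 1) > 0" using Y g by simp
    ultimately show False using zero_le_power2[of t] by linarith
  qed
  then show ?thesis using that by blast
qed

lemma weakly_tendsto_bounded_linear:
  fixes K :: "'u::{real_inner, complete_space} \<Rightarrow> 'v::real_inner"
  assumes "bounded_linear K" and "weakly_tendsto x a"
  shows "weakly_tendsto (\<lambda>n. K (x n)) (K a)"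
  unfolding weakly_tendsto_def
proof
  fix y
  have "bounded_linear (\<lambda>u. K u \<bullet> y)"
    using bounded_linear_compose[OF bounded_linear_inner_left assms(1)] .
  then obtain z where z: "\<And>u. K u \<bullet> y = z \<bullet> u"
    using riesz_representation by blast
  show "(\<lambda>n. K (x n) \<bullet> y) \<longlonglongrightarrow> K a \<bullet> y"
    using assms(2) by (simp add: z weakly_tendsto_def inner_commute[of z])
qed

lemma weak_limit_eq_strong_limit:
  assumes "weakly_tendsto x a" and "x \<longlonglongrightarrow> b"
  shows "a = b"
proof -
  have "a \<bullet> y = b \<bullet> y" for y
  proof (rule LIMSEQ_unique)
    show "(\<lambda>n. x n \<bullet> y) \<longlonglongrightarrow> a \<bullet> y" using assms(1) by (simp add: weakly_tendsto_def)
    show "(\<lambda>n. x n \<bullet> y) \<longlonglongrightarrow> b \<bullet> y" using assms(2) by (intro tendsto_intros)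
  qed
  then show ?thesis by (metis inner_commute vector_eq_rdot)
qed

section \<open>The weighted l1-norm\<close>

text \<open>
  This description by finite partial sums turns lower semicontinuity and the other estimates
  below into statements about finite sums of real numbers.
\<close>

lemma weighted_l1_norm_le_iff:
  assumes "\<And>l. l \<in> \<Lambda> \<Longrightarrow> 0 \<le> w l" and "0 \<le> m"
  shows "weighted_l1_norm \<Lambda> w x \<le> ennreal m \<longleftrightarrow>
    (\<forall>F. finite F \<longrightarrow> F \<subseteq> \<Lambda> \<longrightarrow> (\<Sum>l\<in>F. w l * norm (x l)) \<le> m)"
proof -
  have eq: "(\<Sum>l\<in>F. ennreal (w l * norm (x l))) = ennreal (\<Sum>l\<in>F. w l * norm (x l))"
    if "F \<subseteq> \<Lambda>" for F
    using that assms(1) by (intro sum_ennreal) auto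
  have "weighted_l1_norm \<Lambda> w x
      = (SUP F\<in>{F. finite F \<and> F \<subseteq> \<Lambda>}. \<Sum>l\<in>F. ennreal (w l * norm (x l)))"
    unfolding weighted_l1_norm_def by (rule nonneg_infsum_complete) auto
  also have "\<dots> = (SUP F\<in>{F. finite F \<and> F \<subseteq> \<Lambda>}. ennreal (\<Sum>l\<in>F. w l * norm (x l)))"
    by (rule SUP_cong) (use eq in auto)
  finally show ?thesis
    using assms(2) by (auto simp: SUP_le_iff ennreal_le_iff)
qed

lemma norm_sum_le_of_weighted_l1_norm_le:
  assumes "0 < c" and "\<And>l. l \<in> \<Lambda> \<Longrightarrow> c \<le> w l" and "0 \<le> m"
    and "weighted_l1_norm \<Lambda> w x \<le> ennreal m" and "finite F" and "F \<subseteq> \<Lambda>"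
  shows "(\<Sum>l\<in>F. norm (x l)) \<le> m / c"
proof -
  have "c * (\<Sum>l\<in>F. norm (x l)) \<le> (\<Sum>l\<in>F. w l * norm (x l))"
    unfolding sum_distrib_left using assms by (intro sum_mono mult_right_mono) auto
  also have "\<dots> \<le> m"
    using assms weighted_l1_norm_le_iff[of \<Lambda> w m x] by (meson less_eq_real_def order_trans)
  finally show ?thesis using assms(1) by (simp add: field_simps)
qed

lemma norm_summable_of_weighted_l1_norm_le:
  assumes "0 < c" and "\<And>l. l \<in> \<Lambda> \<Longrightarrow> c \<le> w l" and "0 \<le> m"
    and "weighted_l1_norm \<Lambda> w x \<le> ennreal m"
  shows "(\<lambda>l. norm (x l)) summable_on \<Lambda>" and "(\<Sum>\<^sub>\<infinity>l\<in>\<Lambda>. norm (x l)) \<le> m / c"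
proof -
  note le = norm_sum_le_of_weighted_l1_norm_le[OF assms]
  show summable: "(\<lambda>l. norm (x l)) summable_on \<Lambda>"
    by (rule nonneg_bdd_above_summable_on) (auto intro!: bdd_aboveI[of _ "m / c"] le)
  show "(\<Sum>\<^sub>\<infinity>l\<in>\<Lambda>. norm (x l)) \<le> m / c"
    by (rule infsum_le_finite_sums[OF summable le])
qed

lemma ell2_of_weighted_l1_norm_le:
  assumes "0 < c" and "\<And>l. l \<in> \<Lambda> \<Longrightarrow> c \<le> w l" and "0 \<le> m"
    and "weighted_l1_norm \<Lambda> w x \<le> ennreal m" and "\<And>l. l \<notin> \<Lambda> \<Longrightarrow> x l = 0"
  shows "x \<in> ell2 \<Lambda>" and "ell2_norm \<Lambda> x \<le> m / c"
proof -
  have le: "(\<Sum>l\<in>F. (norm (x l))\<^sup>2) \<le> (m / c)\<^sup>2" if "finite F" "F \<subseteq> \<Lambda>" for F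
  proof -
    have "L2_set (\<lambda>l. norm (x l)) F \<le> (\<Sum>l\<in>F. norm (x l))"
      by (rule L2_set_le_sum) auto
    also have "\<dots> \<le> m / c"
      by (rule norm_sum_le_of_weighted_l1_norm_le[OF assms(1-4) that])
    finally show ?thesis by (metis L2_set_def sqrt_le_D)
  qed
  have summable: "(\<lambda>l. (norm (x l))\<^sup>2) summable_on \<Lambda>"
    by (rule nonneg_bdd_above_summable_on) (auto intro!: bdd_aboveI[of _ "(m / c)\<^sup>2"] le)
  then show "x \<in> ell2 \<Lambda>" using assms(5) by (simp add: ell2_def)
  show "ell2_norm \<Lambda> x \<le> m / c"
    unfolding ell2_norm_def
    by (rule real_le_lsqrt) (use assms infsum_le_finite_sums[OF summable le] in auto)
qed

lemma weighted_l1_norm_lower_semicontinuous: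
  assumes "\<And>l. l \<in> \<Lambda> \<Longrightarrow> 0 \<le> w l"
    and "\<And>n. 0 \<le> m n" and "\<And>n. weighted_l1_norm \<Lambda> w (x n) \<le> ennreal (m n)" and "m \<longlonglongrightarrow> M"
    and "\<And>l. l \<in> \<Lambda> \<Longrightarrow> (\<lambda>n. x n l) \<longlonglongrightarrow> a l"
  shows "weighted_l1_norm \<Lambda> w a \<le> ennreal M"
proof -
  have M: "0 \<le> M" using assms(2,4) by (intro LIMSEQ_le_const) auto
  have "(\<Sum>l\<in>F. w l * norm (a l)) \<le> M" if F: "finite F" "F \<subseteq> \<Lambda>" for F
  proof (rule LIMSEQ_le[OF _ assms(4)])
    show "(\<lambda>n. \<Sum>l\<in>F. w l * norm (x n l)) \<longlonglongrightarrow> (\<Sum>l\<in>F. w l * norm (a l))"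
      using F assms(5) by (intro tendsto_intros) auto
    show "\<exists>N. \<forall>n\<ge>N. (\<Sum>l\<in>F. w l * norm (x n l)) \<le> m n"
      using F assms(1-3) weighted_l1_norm_le_iff[of \<Lambda> w] by blast
  qed
  then show ?thesis using M assms(1) by (simp add: weighted_l1_norm_le_iff)
qed

text \<open>
  The l1-analogue of the Radon--Riesz property: coordinatewise convergence without loss of norm
  in the limit is convergence in norm, since beyond a finite set that carries almost all of the
  norm of the limit, the members of the sequence have almost no mass left.
\<close>

lemma weighted_l1_norm_diff_small:
  fixes x :: "nat \<Rightarrow> 'l \<Rightarrow> 'k::{real_normed_field, euclidean_space}"
  assumes w: "\<And>l. l \<in> \<Lambda> \<Longrightarrow> 0 \<le> w l"
    and m: "\<And>n. 0 \<le> m n" and x: "\<And>n. weighted_l1_norm \<Lambda> w (x n) \<le> ennreal (m n)"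
    and M: "m \<longlonglongrightarrow> M"
    and lim: "\<And>l. l \<in> \<Lambda> \<Longrightarrow> (\<lambda>n. x n l) \<longlonglongrightarrow> a l"
    and a: "weighted_l1_norm \<Lambda> w a = ennreal M"
    and e: "0 < e"
  shows "\<forall>\<^sub>F n in sequentially. weighted_l1_norm \<Lambda> w (\<lambda>l. x n l - a l) \<le> ennreal e"
proof -
  have M0: "0 \<le> M" using M m by (intro LIMSEQ_le_const) auto
  define s where "s y F = (\<Sum>l\<in>F. w l * norm (y l))" for y :: "'l \<Rightarrow> 'k" and F
  have le_iff: "weighted_l1_norm \<Lambda> w y \<le> ennreal k \<longleftrightarrow>
      (\<forall>F. finite F \<longrightarrow> F \<subseteq> \<Lambda> \<longrightarrow> s y F \<le> k)" if "0 \<le> k" for y k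
    unfolding s_def using w that by (rule weighted_l1_norm_le_iff)
  have xs: "s (x n) F \<le> m n" if "finite F" "F \<subseteq> \<Lambda>" for n F
    using le_iff[OF m, of "x n" n] x[of n] that by simp
  have as: "s a F \<le> M" if "finite F" "F \<subseteq> \<Lambda>" for F
    using le_iff[OF M0, of a] a that by simp
  \<comment> \<open>A finite set carrying all but \<open>e / 2\<close> of the norm of the limit.\<close>
  obtain F where F: "finite F" "F \<subseteq> \<Lambda>" "M - e / 2 < s a F"
  proof (cases "M < e / 2")
    case True
    then show ?thesis using that[of "{}"] by (simp add: s_def)
  next
    case False
    then have "ennreal (M - e / 2) < weighted_l1_norm \<Lambda> w a"
      using e by (simp add: a ennreal_less_iff)
    then have "\<not> weighted_l1_norm \<Lambda> w a \<le> ennreal (M - e / 2)" by simp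
    then obtain F where "finite F" "F \<subseteq> \<Lambda>" "\<not> s a F \<le> M - e / 2"
      using False le_iff[of "M - e / 2" a] by (auto simp: not_less)
    then show ?thesis using that by simp
  qed
  \<comment> \<open>The summands of \<open>b n\<close> bound the difference on \<open>F\<close>, the mass of \<open>x n\<close> off \<open>F\<close>, and the mass of
    \<open>a\<close> off \<open>F\<close>.\<close>
  define b where "b n = s (\<lambda>l. x n l - a l) F + (m n - s (x n) F) + (M - s a F)" for n
  have "b \<longlonglongrightarrow> s (\<lambda>l. a l - a l) F + (M - s a F) + (M - s a F)"
    unfolding b_def s_def using F lim by (intro tendsto_intros M) auto
  moreover have "s (\<lambda>l. a l - a l) F + (M - s a F) + (M - s a F) < e"
    using F(3) by (simp add: s_def)
  ultimately have "\<forall>\<^sub>F n in sequentially. b n < e" by (rule order_tendstoD(2))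
  then show ?thesis
  proof (rule eventually_mono)
    fix n assume n: "b n < e"
    have "s (\<lambda>l. x n l - a l) G \<le> e" if G: "finite G" "G \<subseteq> \<Lambda>" for G
    proof -
      have split: "s y (G \<union> F) = s y F + s y (G - F)" for y
      proof -
        have "G \<union> F = F \<union> (G - F)" by auto
        then show ?thesis
          using F G unfolding s_def by (metis Diff_disjoint finite_Diff sum.union_disjoint)
      qed
      have "s (\<lambda>l. x n l - a l) G \<le> s (\<lambda>l. x n l - a l) (G \<union> F)"
        unfolding s_def using F G w by (intro sum_mono2) auto
      also have "\<dots> = s (\<lambda>l. x n l - a l) F + s (\<lambda>l. x n l - a l) (G - F)" by (rule split)
      also have "s (\<lambda>l. x n l - a l) (G - F) \<le> s (x n) (G - F) + s a (G - F)"
        unfolding s_def sum.distrib[symmetric] distrib_left[symmetric]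
        using G w by (intro sum_mono mult_left_mono norm_triangle_ineq4) auto
      also have "s (x n) (G - F) \<le> m n - s (x n) F"
        using split[of "x n"] xs[of "G \<union> F" n] F G by simp
      also have "s a (G - F) \<le> M - s a F"
        using split[of a] as[of "G \<union> F"] F G by simp
      finally show ?thesis using n by (simp add: b_def)
    qed
    then show "weighted_l1_norm \<Lambda> w (\<lambda>l. x n l - a l) \<le> ennreal e"
      using e by (simp add: le_iff)
  qed
qed

text \<open>
  Bounds in the weighted l1-norm make Hoelder's inequality between the l1-norm and the supremum
  norm sufficient, as the coordinates of a square-summable family tend to zero.
\<close>

lemma ell2_weakly_tendsto_of_pointwise:
  fixes x :: "nat \<Rightarrow> 'l \<Rightarrow> 'k::{real_normed_field, euclidean_space}"
  assumes c: "0 < c" "\<And>l. l \<in> \<Lambda> \<Longrightarrow> c \<le> w l" and C: "0 \<le> C"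
    and x: "\<And>n. weighted_l1_norm \<Lambda> w (x n) \<le> ennreal C" "\<And>n l. l \<notin> \<Lambda> \<Longrightarrow> x n l = 0"
    and a: "weighted_l1_norm \<Lambda> w a \<le> ennreal C" "\<And>l. l \<notin> \<Lambda> \<Longrightarrow> a l = 0"
    and lim: "\<And>l. l \<in> \<Lambda> \<Longrightarrow> (\<lambda>n. x n l) \<longlonglongrightarrow> a l"
  shows "ell2_weakly_tendsto \<Lambda> x a"
  unfolding ell2_weakly_tendsto_def
proof (intro conjI allI ballI)
  show "x n \<in> ell2 \<Lambda>" for n by (rule ell2_of_weighted_l1_norm_le(1)[OF c C x])
  show "a \<in> ell2 \<Lambda>" by (rule ell2_of_weighted_l1_norm_le(1)[OF c C a])
  fix y :: "'l \<Rightarrow> 'k" assume "y \<in> ell2 \<Lambda>"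
  then have y: "(\<lambda>l. (norm (y l))\<^sup>2) summable_on \<Lambda>" by (simp add: ell2_def)
  define Y where "Y = sqrt (\<Sum>\<^sub>\<infinity>l\<in>\<Lambda>. (norm (y l))\<^sup>2)"
  have Y: "norm (y l) \<le> Y" if "l \<in> \<Lambda>" for l
    unfolding Y_def using finite_sum_le_infsum[OF y, of "{l}"] that
    by (intro real_le_rsqrt) auto
  note xs = norm_summable_of_weighted_l1_norm_le[OF c C x(1)]
  note as = norm_summable_of_weighted_l1_norm_le[OF c C a(1)]
  have inner_summable: "(\<lambda>l. z l \<bullet> y l) summable_on \<Lambda>"
    if "(\<lambda>l. norm (z l)) summable_on \<Lambda>" for z :: "'l \<Rightarrow> 'k"
  proof (rule abs_summable_summable, rule Infinite_Sum.abs_summable_on_comparison_test')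
    show "(\<lambda>l. norm (z l) * Y) summable_on \<Lambda>" using that by (rule summable_on_cmult_left)
    show "norm (z l \<bullet> y l) \<le> norm (z l) * Y" if "l \<in> \<Lambda>" for l
      using Y[OF that] Cauchy_Schwarz_ineq2[of "z l" "y l"]
      by (metis mult_left_mono norm_ge_zero order_trans real_norm_def)
  qed
  define d where "d n l = x n l - a l" for n l
  have ds: "(\<lambda>l. norm (d n l)) summable_on \<Lambda>" for n
    by (rule Infinite_Sum.abs_summable_on_comparison_test'[OF summable_on_add[OF xs(1)[of n] as(1)]])
       (auto simp: d_def norm_triangle_ineq4)
  have ds_le: "(\<Sum>\<^sub>\<infinity>l\<in>\<Lambda>. norm (d n l)) \<le> 2 * C / c" for n
  proof -
    have "(\<Sum>\<^sub>\<infinity>l\<in>\<Lambda>. norm (d n l)) \<le> (\<Sum>\<^sub>\<infinity>l\<in>\<Lambda>. norm (x n l) + norm (a l))"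
      using ds by (intro infsum_mono summable_on_add xs as) (auto simp: d_def norm_triangle_ineq4)
    also have "\<dots> = (\<Sum>\<^sub>\<infinity>l\<in>\<Lambda>. norm (x n l)) + (\<Sum>\<^sub>\<infinity>l\<in>\<Lambda>. norm (a l))"
      by (intro infsum_add xs as)
    finally show ?thesis using xs(2)[of n] as(2) by simp
  qed
  have diff: "ell2_inner \<Lambda> (x n) y - ell2_inner \<Lambda> a y = (\<Sum>\<^sub>\<infinity>l\<in>\<Lambda>. d n l \<bullet> y l)" for n
  proof -
    have "ell2_inner \<Lambda> (x n) y = (\<Sum>\<^sub>\<infinity>l\<in>\<Lambda>. d n l \<bullet> y l + a l \<bullet> y l)"
      by (simp add: ell2_inner_def d_def inner_diff_left)
    also have "\<dots> = (\<Sum>\<^sub>\<infinity>l\<in>\<Lambda>. d n l \<bullet> y l) + ell2_inner \<Lambda> a y"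
      unfolding ell2_inner_def by (intro infsum_add inner_summable ds as c(2))
    finally show ?thesis by simp
  qed
  show "(\<lambda>n. ell2_inner \<Lambda> (x n) y) \<longlonglongrightarrow> ell2_inner \<Lambda> a y"
  proof (rule LIMSEQ_I, unfold diff)
    fix e :: real assume e: "0 < e"
    \<comment> \<open>Outside a finite set \<open>F\<close> the coordinates of \<open>y\<close> are at most \<open>r\<close>, so that the terms there
      contribute at most \<open>r\<close> times the uniform bound \<open>2 * C / c\<close> on the l1-norm of \<open>d n\<close>.\<close>
    define r where "r = (e / 2) / (2 * C / c + 1)"
    have pos: "0 < 2 * C / c + 1" using C c(1) by (intro add_nonneg_pos) auto
    then have r: "0 < r" using e by (simp add: r_def)
    obtain F where F: "finite F" "F \<subseteq> \<Lambda>"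
      "dist (\<Sum>l\<in>F. (norm (y l))\<^sup>2) (\<Sum>\<^sub>\<infinity>l\<in>\<Lambda>. (norm (y l))\<^sup>2) \<le> r\<^sup>2"
      using infsum_finite_approximation[OF y, of "r\<^sup>2"] r by auto
    have tail: "norm (y l) \<le> r" if l: "l \<in> \<Lambda> - F" for l
    proof -
      have "(\<Sum>l\<in>insert l F. (norm (y l))\<^sup>2) \<le> (\<Sum>\<^sub>\<infinity>l\<in>\<Lambda>. (norm (y l))\<^sup>2)"
        by (rule finite_sum_le_infsum[OF y]) (use F l in auto)
      moreover have "(\<Sum>l\<in>insert l F. (norm (y l))\<^sup>2) = (norm (y l))\<^sup>2 + (\<Sum>l\<in>F. (norm (y l))\<^sup>2)"
        using F(1) l by simp
      ultimately have "(norm (y l))\<^sup>2 \<le> r\<^sup>2"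
        using F(3) unfolding dist_real_def by linarith
      then show ?thesis by (rule power2_le_imp_le) (use r in simp)
    qed
    have "(\<lambda>n. \<Sum>l\<in>F. norm (d n l) * Y) \<longlonglongrightarrow> (\<Sum>l\<in>F. norm (a l - a l) * Y)"
      unfolding d_def using F lim by (intro tendsto_intros) auto
    then have "\<forall>\<^sub>F n in sequentially. (\<Sum>l\<in>F. norm (d n l) * Y) < e / 2"
      using e by (intro order_tendstoD(2)) auto
    then obtain N where N: "\<And>n. n \<ge> N \<Longrightarrow> (\<Sum>l\<in>F. norm (d n l) * Y) < e / 2"
      by (auto simp: eventually_sequentially)
    have "norm (\<Sum>\<^sub>\<infinity>l\<in>\<Lambda>. d n l \<bullet> y l) < e" if n: "n \<ge> N" for n
    proof -
      define g where "g l = norm (d n l) * (if l \<in> F then Y else 0)" for l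
      have gsum: "(g has_sum (\<Sum>l\<in>F. norm (d n l) * Y)) \<Lambda>"
      proof -
        have "(g has_sum (\<Sum>l\<in>F. g l)) \<Lambda>"
          by (rule has_sum_finite_neutralI) (use F in \<open>auto simp: g_def\<close>)
        then show ?thesis by (simp add: g_def)
      qed
      have rsum: "((\<lambda>l. norm (d n l) * r) has_sum ((\<Sum>\<^sub>\<infinity>l\<in>\<Lambda>. norm (d n l)) * r)) \<Lambda>"
        by (rule has_sum_cmult_left) (use ds in auto)
      have dsum: "((\<lambda>l. d n l \<bullet> y l) has_sum (\<Sum>\<^sub>\<infinity>l\<in>\<Lambda>. d n l \<bullet> y l)) \<Lambda>"
        using inner_summable[OF ds] by (rule has_sum_infsum)
      have "norm (\<Sum>\<^sub>\<infinity>l\<in>\<Lambda>. d n l \<bullet> y l)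
          \<le> (\<Sum>l\<in>F. norm (d n l) * Y) + (\<Sum>\<^sub>\<infinity>l\<in>\<Lambda>. norm (d n l)) * r"
      proof (rule norm_infsum_le[OF dsum has_sum_add[OF gsum rsum]])
        fix l assume l: "l \<in> \<Lambda>"
        have "norm (d n l \<bullet> y l) \<le> norm (d n l) * norm (y l)"
          using Cauchy_Schwarz_ineq2[of "d n l" "y l"] by simp
        also have "\<dots> \<le> norm (d n l) * ((if l \<in> F then Y else 0) + r)"
          using Y[OF l] tail[of l] l r by (intro mult_left_mono) auto
        finally show "norm (d n l \<bullet> y l) \<le> g l + norm (d n l) * r"
          by (simp add: g_def distrib_left)
      qed
      also have "(\<Sum>\<^sub>\<infinity>l\<in>\<Lambda>. norm (d n l)) * r \<le> (2 * C / c + 1) * r"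
        using ds_le[of n] r by (intro mult_right_mono) auto
      also have "(2 * C / c + 1) * r = e / 2"
        using pos by (metis r_def less_irrefl mult.commute nonzero_divide_eq_eq)
      finally show ?thesis using N[OF n] by simp
    qed
    then show "\<exists>N. \<forall>n\<ge>N. norm (\<Sum>\<^sub>\<infinity>l\<in>\<Lambda>. d n l \<bullet> y l) < e" by blast
  qed
qed

lemma ell2_tendsto_of_pointwise_of_weighted_l1_norm:
  assumes c: "0 < c" "\<And>l. l \<in> \<Lambda> \<Longrightarrow> c \<le> w l"
    and m: "\<And>n. 0 \<le> m n" and x: "\<And>n. weighted_l1_norm \<Lambda> w (x n) \<le> ennreal (m n)"
    and M: "m \<longlonglongrightarrow> M"
    and lim: "\<And>l. l \<in> \<Lambda> \<Longrightarrow> (\<lambda>n. x n l) \<longlonglongrightarrow> a l"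
    and a: "weighted_l1_norm \<Lambda> w a = ennreal M"
    and mem: "\<And>n. x n \<in> ell2 \<Lambda>" "a \<in> ell2 \<Lambda>"
  shows "ell2_tendsto \<Lambda> x a"
  unfolding ell2_tendsto_def
proof (intro conjI allI mem LIMSEQ_I)
  fix e :: real assume e: "0 < e"
  have w: "0 \<le> w l" if "l \<in> \<Lambda>" for l using c(1) c(2)[OF that] by simp
  have "\<forall>\<^sub>F n in sequentially. weighted_l1_norm \<Lambda> w (\<lambda>l. x n l - a l) \<le> ennreal (c * (e / 2))"
    using e c(1) by (intro weighted_l1_norm_diff_small[OF w m x M lim a]) auto
  then obtain N where N:
    "\<And>n. n \<ge> N \<Longrightarrow> weighted_l1_norm \<Lambda> w (\<lambda>l. x n l - a l) \<le> ennreal (c * (e / 2))"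
    by (auto simp: eventually_sequentially)
  have "norm (ell2_norm \<Lambda> (\<lambda>l. x n l - a l) - 0) < e" if n: "n \<ge> N" for n
  proof -
    have "ell2_norm \<Lambda> (\<lambda>l. x n l - a l) \<le> c * (e / 2) / c"
      by (rule ell2_of_weighted_l1_norm_le(2)[OF c _ N[OF n]])
         (use e c(1) mem in \<open>auto simp: ell2_def\<close>)
    moreover have "0 \<le> ell2_norm \<Lambda> (\<lambda>l. x n l - a l)"
      unfolding ell2_norm_def by (intro real_sqrt_ge_zero infsum_nonneg) auto
    ultimately show ?thesis using c(1) e by simp
  qed
  then show "\<exists>N. \<forall>n\<ge>N. norm (ell2_norm \<Lambda> (\<lambda>l. x n l - a l) - 0) < e" by blast
qed

lemma ell2_tendsto_pointwise:
  assumes "ell2_tendsto \<Lambda> x a" and l: "l \<in> \<Lambda>"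
  shows "(\<lambda>n. x n l) \<longlonglongrightarrow> a l"
proof -
  have mem: "\<And>n. x n \<in> ell2 \<Lambda>" "a \<in> ell2 \<Lambda>"
    and lim: "(\<lambda>n. ell2_norm \<Lambda> (\<lambda>l. x n l - a l)) \<longlonglongrightarrow> 0"
    using assms(1) by (auto simp: ell2_tendsto_def)
  have "norm (x n l - a l) \<le> ell2_norm \<Lambda> (\<lambda>l. x n l - a l)" for n
  proof -
    have "(\<lambda>l. 2 * (norm (x n l))\<^sup>2 + 2 * (norm (a l))\<^sup>2) summable_on \<Lambda>"
      using mem by (intro summable_on_add summable_on_cmult_right) (auto simp: ell2_def)
    then have summable: "(\<lambda>l. (norm (x n l - a l))\<^sup>2) summable_on \<Lambda>"
    proof (rule Infinite_Sum.summable_on_comparison_test)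
      fix l
      have "(norm (x n l - a l))\<^sup>2 \<le> (norm (x n l) + norm (a l))\<^sup>2"
        by (intro power_mono norm_triangle_ineq4) auto
      also have "\<dots> \<le> 2 * (norm (x n l))\<^sup>2 + 2 * (norm (a l))\<^sup>2"
        using zero_le_power2[of "norm (x n l) - norm (a l)"] by (simp add: power2_sum power2_diff)
      finally show "(norm (x n l - a l))\<^sup>2 \<le> 2 * (norm (x n l))\<^sup>2 + 2 * (norm (a l))\<^sup>2" .
    qed auto
    show ?thesis
      unfolding ell2_norm_def using finite_sum_le_infsum[OF summable, of "{l}"] l
      by (intro real_le_rsqrt) auto
  qed
  then have "(\<lambda>n. x n l - a l) \<longlonglongrightarrow> 0"
    by (intro Lim_null_comparison[OF _ lim]) auto
  then show ?thesis by (rule LIM_zero_cancel)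
qed

section \<open>Approximation of the synthesis operator\<close>

lemma norm_diff_le_Delta:
  assumes "x \<in> ell2 \<Lambda>" and "ell2_norm \<Lambda> x \<le> r"
  shows "ennreal (norm (Da a x - D x)) \<le> Delta \<Lambda> D Da r a"
  unfolding Delta_def using assms by (intro SUP_upper) auto

text \<open>
  A limit of weakly sequentially continuous maps, uniform on a ball, is weakly sequentially
  continuous on that ball.
\<close>

lemma weakly_tendsto_of_Delta_tendsto:
  fixes D :: "('l \<Rightarrow> 'k::{real_normed_field, euclidean_space}) \<Rightarrow> 'u::real_inner"
  assumes cont: "\<And>a. a > 0 \<Longrightarrow> weakly_seq_continuous \<Lambda> (Da a)"
    and Delta: "(Delta \<Lambda> D Da r \<longlongrightarrow> 0) (at_right 0)"
    and weak: "ell2_weakly_tendsto \<Lambda> x a"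
    and r: "\<And>n. ell2_norm \<Lambda> (x n) \<le> r" "ell2_norm \<Lambda> a \<le> r"
  shows "weakly_tendsto (\<lambda>n. D (x n)) (D a)"
  unfolding weakly_tendsto_def
proof (intro allI LIMSEQ_I)
  fix y :: 'u and e :: real assume e: "0 < e"
  define e' where "e' = (e / 3) / (norm y + 1)"
  have e': "0 < e'" using e by (simp add: e'_def add_nonneg_pos)
  have "e' * norm y \<le> e' * (norm y + 1)" using e' by simp
  also have "\<dots> = e / 3"
  proof -
    have "norm y + 1 \<noteq> 0" using norm_ge_zero[of y] by linarith
    then show ?thesis by (metis e'_def nonzero_divide_eq_eq)
  qed
  finally have e'y: "e' * norm y \<le> e / 3" .
  have "\<forall>\<^sub>F t in at_right 0. Delta \<Lambda> D Da r t < ennreal e'"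
    using Delta e' by (intro order_tendstoD(2)) auto
  moreover have "\<forall>\<^sub>F t in at_right (0::real). 0 < t" by (rule eventually_at_right_less)
  ultimately have "\<forall>\<^sub>F t in at_right 0. Delta \<Lambda> D Da r t < ennreal e' \<and> 0 < t"
    by (rule eventually_conj)
  then obtain t where t: "Delta \<Lambda> D Da r t < ennreal e'" "0 < t"
    using eventually_happens[of _ "at_right (0::real)"] by auto
  have close: "\<bar>Da t z \<bullet> y - D z \<bullet> y\<bar> \<le> e / 3" if "z \<in> ell2 \<Lambda>" "ell2_norm \<Lambda> z \<le> r" for z
  proof -
    have "ennreal (norm (Da t z - D z)) < ennreal e'"
      using norm_diff_le_Delta[OF that, of Da t D] t(1) by simp
    then have "norm (Da t z - D z) \<le> e'" using e' by (simp add: ennreal_less_iff)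
    then have "norm (Da t z - D z) * norm y \<le> e' * norm y" by (intro mult_right_mono) auto
    then show ?thesis
      using Cauchy_Schwarz_ineq2[of "Da t z - D z" y] e'y by (simp add: inner_diff_left)
  qed
  have "(\<lambda>n. Da t (x n) \<bullet> y) \<longlonglongrightarrow> Da t a \<bullet> y"
    using cont[OF t(2)] weak by (simp add: weakly_seq_continuous_def weakly_tendsto_def)
  then obtain N where N: "\<And>n. n \<ge> N \<Longrightarrow> norm (Da t (x n) \<bullet> y - Da t a \<bullet> y) < e / 3"
    using e LIMSEQ_D[of "\<lambda>n. Da t (x n) \<bullet> y" "Da t a \<bullet> y" "e / 3"] by auto
  have "norm (D (x n) \<bullet> y - D a \<bullet> y) < e" if "n \<ge> N" for n
  proof -
    have "x n \<in> ell2 \<Lambda>" "a \<in> ell2 \<Lambda>" using weak by (auto simp: ell2_weakly_tendsto_def)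
    note close = close[OF this(1) r(1)] close[OF this(2) r(2)]
    show ?thesis using close N[OF that] unfolding real_norm_def by linarith
  qed
  then show "\<exists>N. \<forall>n\<ge>N. norm (D (x n) \<bullet> y - D a \<bullet> y) < e" by blast
qed

section \<open>Convergence of the regularized solutions\<close>

text \<open>
  The sequence need not consist of minimizers.  It only has to solve the equation asymptotically,
  with weighted l1-norms that in the limit do not exceed the minimal value \<open>M\<close>.
\<close>

lemma minimizing_solution_limit:
  fixes K :: "'u::{real_inner, complete_space} \<Rightarrow> 'v::{real_inner, complete_space}"
    and D :: "('l \<Rightarrow> 'k::{real_normed_field, euclidean_space}) \<Rightarrow> 'u"
  assumes K: "bounded_linear K"
    and Da: "\<And>b. b > 0 \<Longrightarrow> weakly_seq_continuous \<Lambda> (Da b)"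
    and Delta: "\<And>r. r > 0 \<Longrightarrow> (Delta \<Lambda> D Da r \<longlongrightarrow> 0) (at_right 0)"
    and c: "0 < c" "\<And>l. l \<in> \<Lambda> \<Longrightarrow> c \<le> w l"
    and z: "minimizing_solution \<Lambda> w (K \<circ> D) v z" "weighted_l1_norm \<Lambda> w z = ennreal M"
    and m: "\<And>n. 0 \<le> m n" "m \<longlonglongrightarrow> M"
    and x: "\<And>n. x n \<in> ell2 \<Lambda>" "\<And>n. weighted_l1_norm \<Lambda> w (x n) \<le> ennreal (m n)"
    and lim: "\<And>l. l \<in> \<Lambda> \<Longrightarrow> (\<lambda>n. x n l) \<longlonglongrightarrow> a l" and a: "\<And>l. l \<notin> \<Lambda> \<Longrightarrow> a l = 0"
    and data: "(\<lambda>n. K (D (x n))) \<longlonglongrightarrow> v"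
  shows "minimizing_solution \<Lambda> w (K \<circ> D) v a" and "ell2_tendsto \<Lambda> x a"
proof -
  have w: "0 \<le> w l" if "l \<in> \<Lambda>" for l using c(1) c(2)[OF that] by simp
  have x0: "x n l = 0" if "l \<notin> \<Lambda>" for n l using x(1)[of n] that by (simp add: ell2_def)
  have M: "0 \<le> M" using m by (intro LIMSEQ_le_const[OF m(2)]) auto
  have aM: "weighted_l1_norm \<Lambda> w a \<le> ennreal M"
    by (rule weighted_l1_norm_lower_semicontinuous[OF w m(1) x(2) m(2) lim])
  have a_mem: "a \<in> ell2 \<Lambda>" by (rule ell2_of_weighted_l1_norm_le(1)[OF c M aM a])
  obtain C0 where C0: "\<And>n. m n \<le> C0"
    using convergent_imp_Bseq[OF convergentI[OF m(2)]] unfolding Bseq_def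
    by (metis abs_le_D1 real_norm_def)
  define C where "C = max C0 M"
  have C: "0 \<le> C" "m n \<le> C" "M \<le> C" for n
    using M C0[of n] by (auto simp: C_def le_max_iff_disj)
  have xC: "weighted_l1_norm \<Lambda> w (x n) \<le> ennreal C" for n
    using x(2)[of n] C(2)[of n] ennreal_leI order_trans by blast
  have aC: "weighted_l1_norm \<Lambda> w a \<le> ennreal C"
    using aM C(3) ennreal_leI order_trans by blast
  have weak: "ell2_weakly_tendsto \<Lambda> x a"
    by (rule ell2_weakly_tendsto_of_pointwise[OF c C(1) xC x0 aC a lim])
  \<comment> \<open>The radius must be positive, and \<open>C\<close> may be zero.\<close>
  define r where "r = C / c + 1"
  have r: "0 < r" using C(1) c(1) by (simp add: r_def add_nonneg_pos)
  have x_r: "ell2_norm \<Lambda> (x n) \<le> r" for n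
    using ell2_of_weighted_l1_norm_le(2)[OF c C(1) xC x0] by (simp add: r_def add_increasing2)
  have a_r: "ell2_norm \<Lambda> a \<le> r"
    using ell2_of_weighted_l1_norm_le(2)[OF c C(1) aC a] by (simp add: r_def add_increasing2)
  have "weakly_tendsto (\<lambda>n. D (x n)) (D a)"
    by (rule weakly_tendsto_of_Delta_tendsto[OF Da Delta[OF r] weak x_r a_r])
  then have "weakly_tendsto (\<lambda>n. K (D (x n))) (K (D a))"
    by (rule weakly_tendsto_bounded_linear[OF K])
  then have sol: "K (D a) = v" using data by (rule weak_limit_eq_strong_limit)
  have min: "weighted_l1_norm \<Lambda> w z \<le> weighted_l1_norm \<Lambda> w y" if "y \<in> ell2 \<Lambda>" "K (D y) = v" for y
    using z(1) that by (auto simp: minimizing_solution_def is_arg_min_linorder)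
  have eq: "weighted_l1_norm \<Lambda> w a = ennreal M"
    using min[OF a_mem sol] aM z(2) by simp
  show "minimizing_solution \<Lambda> w (K \<circ> D) v a"
    using a_mem sol min eq z(2) by (auto simp: minimizing_solution_def is_arg_min_linorder)
  show "ell2_tendsto \<Lambda> x a"
    by (rule ell2_tendsto_of_pointwise_of_weighted_l1_norm[OF c m(1) x(2) m(2) lim eq x(1) a_mem])
qed

theorem theorem2p4:
  fixes K :: "'u::{real_inner, complete_space} \<Rightarrow> 'v::{real_inner, complete_space}"
    and \<Lambda> :: "'l set"
    and D :: "('l \<Rightarrow> 'k::{real_normed_field, euclidean_space}) \<Rightarrow> 'u"
    and Da :: "real \<Rightarrow> ('l \<Rightarrow> 'k) \<Rightarrow> 'u"
    and w :: "'l \<Rightarrow> real"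
    and v :: 'v
    and \<xi>\<^sub>d :: "'l \<Rightarrow> 'k"
    and \<rho> :: real
    and \<alpha> :: "real \<Rightarrow> real"
    and \<delta> :: "nat \<Rightarrow> real"
    and vs :: "nat \<Rightarrow> 'v"
    and \<xi> :: "nat \<Rightarrow> 'l \<Rightarrow> 'k"
  assumes "bounded_linear K"
    and "countable \<Lambda>"
    and "\<And>a. a > 0 \<Longrightarrow> weakly_seq_continuous \<Lambda> (Da a)"
    and "\<And>l. l \<in> \<Lambda> \<Longrightarrow> w l > 0"
    and "(INF l\<in>\<Lambda>. ereal (w l)) > 0"
    and "\<And>r. r > 0 \<Longrightarrow> (Delta \<Lambda> D Da r \<longlongrightarrow> 0) (at_right 0)"
    and "minimizing_solution \<Lambda> w (K \<circ> D) v \<xi>\<^sub>d"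
    and "\<rho> > ell2_norm \<Lambda> \<xi>\<^sub>d"
    and "\<And>d. d > 0 \<Longrightarrow> \<alpha> d > 0"
    and "(\<alpha> \<longlongrightarrow> 0) (at_right 0)"
    and "((\<lambda>d. (Delta \<Lambda> D Da \<rho> (\<alpha> d))\<^sup>2 / ennreal (\<alpha> d)) \<longlongrightarrow> 0) (at_right 0)"
    and "((\<lambda>d. d\<^sup>2 / \<alpha> d) \<longlongrightarrow> 0) (at_right 0)"
    and "\<And>k. \<delta> k > 0"
    and "\<delta> \<longlonglongrightarrow> 0"
    and "\<And>k. norm (v - vs k) \<le> \<delta> k"
    and "\<And>k. is_arg_min (synthesis_functional \<Lambda> w K Da (\<alpha> (\<delta> k)) (vs k)) (\<lambda>\<eta>. \<eta> \<in> ell2 \<Lambda>) (\<xi> k)"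
  shows "(\<exists>r \<eta>. strict_mono r \<and> ell2_tendsto \<Lambda> (\<xi> \<circ> r) \<eta>)
    \<and> (\<forall>r \<eta>. strict_mono r \<and> ell2_tendsto \<Lambda> (\<xi> \<circ> r) \<eta> \<longrightarrow> minimizing_solution \<Lambda> w (K \<circ> D) v \<eta>)
    \<and> ((\<exists>!\<eta>. minimizing_solution \<Lambda> w (K \<circ> D) v \<eta>) \<longrightarrow> ell2_tendsto \<Lambda> \<xi> \<xi>\<^sub>d)"
proof -
  note K = assms(1) and countable = assms(2) and Da_cont = assms(3) and Delta0 = assms(6)
    and \<xi>d = assms(7) and \<rho> = assms(8) and \<alpha>_pos = assms(9) and \<alpha>0 = assms(10)
    and Delta\<alpha> = assms(11) and \<delta>\<alpha> = assms(12) and \<delta>_pos = assms(13) and \<delta>0 = assms(14)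
    and noise = assms(15) and \<xi> = assms(16)
  interpret K: bounded_linear K by (rule K)
  obtain B where B: "0 \<le> B" "\<And>u. norm (K u) \<le> norm u * B"
    using K.nonneg_bounded by blast
  obtain c where c: "0 < c" "\<And>l. l \<in> \<Lambda> \<Longrightarrow> c \<le> w l"
  proof -
    obtain c where c: "0 < ereal c" "ereal c < (INF l\<in>\<Lambda>. ereal (w l))"
      using ereal_dense2[OF assms(5)] by auto
    then have "c \<le> w l" if "l \<in> \<Lambda>" for l
      using less_INF_D[OF c(2) that] by simp
    with c(1) show ?thesis using that by simp
  qed
  have \<xi>d_mem: "\<xi>\<^sub>d \<in> ell2 \<Lambda>" and \<xi>d_sol: "K (D \<xi>\<^sub>d) = v"
    and \<xi>d_fin: "weighted_l1_norm \<Lambda> w \<xi>\<^sub>d < \<infinity>"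
    using \<xi>d by (auto simp: minimizing_solution_def is_arg_min_def)
  obtain M where M: "0 \<le> M" "weighted_l1_norm \<Lambda> w \<xi>\<^sub>d = ennreal M"
    using \<xi>d_fin by (cases "weighted_l1_norm \<Lambda> w \<xi>\<^sub>d") auto
  have \<xi>_mem: "\<xi> k \<in> ell2 \<Lambda>" for k using \<xi>[of k] by (simp add: is_arg_min_def)
  define a where "a k = \<alpha> (\<delta> k)" for k
  have a: "0 < a k" for k using \<alpha>_pos \<delta>_pos by (simp add: a_def)
  have \<delta>_right: "filterlim \<delta> (at_right 0) sequentially"
    unfolding filterlim_at
    using \<delta>0 \<delta>_pos less_imp_neq[OF \<delta>_pos] by (auto intro!: always_eventually)
  have a0: "a \<longlonglongrightarrow> 0"
    unfolding a_def using filterlim_compose[OF \<alpha>0 \<delta>_right] .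
  have a_right: "filterlim a (at_right 0) sequentially"
    unfolding filterlim_at
    using a0 a less_imp_neq[OF a] by (auto intro!: always_eventually)
  \<comment> \<open>The squared residual of the exact solution, divided by the regularization parameter, vanishes.\<close>
  define N where "N k = norm (K (Da (a k) \<xi>\<^sub>d) - vs k)" for k
  define m where "m k = (N k)\<^sup>2 / a k + M" for k
  have m0: "0 \<le> m k" for k using a[of k] M by (simp add: m_def)
  have mM: "m \<longlonglongrightarrow> M"
  proof -
    define E where "E k = norm (Da (a k) \<xi>\<^sub>d - D \<xi>\<^sub>d)" for k
    have "(\<lambda>k. ennreal ((E k)\<^sup>2 / a k)) \<longlonglongrightarrow> 0"
    proof (rule tendsto_sandwich[OF _ _ tendsto_const])
      show "(\<lambda>k. (Delta \<Lambda> D Da \<rho> (\<alpha> (\<delta> k)))\<^sup>2 / ennreal (\<alpha> (\<delta> k))) \<longlonglongrightarrow> 0"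
        by (rule filterlim_compose[OF Delta\<alpha> \<delta>_right])
      have "ennreal ((E k)\<^sup>2 / a k) \<le> (Delta \<Lambda> D Da \<rho> (\<alpha> (\<delta> k)))\<^sup>2 / ennreal (\<alpha> (\<delta> k))" for k
      proof -
        have "ennreal (E k) \<le> Delta \<Lambda> D Da \<rho> (a k)"
          unfolding E_def using \<xi>d_mem \<rho> by (intro norm_diff_le_Delta) auto
        then have "(ennreal (E k))\<^sup>2 / ennreal (a k) \<le> (Delta \<Lambda> D Da \<rho> (a k))\<^sup>2 / ennreal (a k)"
          by (intro divide_right_mono_ennreal power_mono_ennreal) auto
        moreover have "ennreal ((E k)\<^sup>2 / a k) = (ennreal (E k))\<^sup>2 / ennreal (a k)"
          using a[of k] by (simp add: divide_ennreal ennreal_power E_def)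
        ultimately show ?thesis by (simp add: a_def)
      qed
      then show "\<forall>\<^sub>F k in sequentially. ennreal ((E k)\<^sup>2 / a k)
          \<le> (Delta \<Lambda> D Da \<rho> (\<alpha> (\<delta> k)))\<^sup>2 / ennreal (\<alpha> (\<delta> k))" by simp
    qed simp
    then have E: "(\<lambda>k. (E k)\<^sup>2 / a k) \<longlonglongrightarrow> 0"
      using a tendsto_ennreal_iff[of "\<lambda>k. (E k)\<^sup>2 / a k" sequentially 0]
      by (simp add: less_imp_le)
    have \<delta>a: "(\<lambda>k. (\<delta> k)\<^sup>2 / a k) \<longlonglongrightarrow> 0"
      unfolding a_def using filterlim_compose[OF \<delta>\<alpha> \<delta>_right] .
    have N_le: "(N k)\<^sup>2 / a k \<le> 2 * B\<^sup>2 * ((E k)\<^sup>2 / a k) + 2 * ((\<delta> k)\<^sup>2 / a k)" for k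
    proof -
      have "N k = norm (K (Da (a k) \<xi>\<^sub>d - D \<xi>\<^sub>d) + (v - vs k))"
        by (simp add: N_def K.diff \<xi>d_sol)
      also have "\<dots> \<le> E k * B + \<delta> k"
        unfolding E_def by (intro norm_triangle_mono B noise)
      finally have "(N k)\<^sup>2 \<le> (E k * B + \<delta> k)\<^sup>2"
        by (intro power_mono) (auto simp: N_def)
      also have "\<dots> \<le> 2 * B\<^sup>2 * (E k)\<^sup>2 + 2 * (\<delta> k)\<^sup>2"
        using zero_le_power2[of "E k * B - \<delta> k"]
        by (simp add: power2_sum power2_diff power_mult_distrib algebra_simps)
      finally have "(N k)\<^sup>2 / a k \<le> (2 * B\<^sup>2 * (E k)\<^sup>2 + 2 * (\<delta> k)\<^sup>2) / a k"
        using a[of k] by (intro divide_right_mono) auto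
      then show ?thesis by (simp add: add_divide_distrib)
    qed
    have bound: "(\<lambda>k. 2 * B\<^sup>2 * ((E k)\<^sup>2 / a k) + 2 * ((\<delta> k)\<^sup>2 / a k)) \<longlonglongrightarrow> 0"
      using tendsto_add[OF tendsto_mult_left[OF E, of "2 * B\<^sup>2"] tendsto_mult_left[OF \<delta>a, of 2]]
      by (simp only: mult_zero_right add_0_right)
    have "(\<lambda>k. (N k)\<^sup>2 / a k) \<longlonglongrightarrow> 0"
      by (rule tendsto_sandwich[OF _ _ tendsto_const bound])
         (use a N_le in \<open>auto simp: less_imp_le\<close>)
    from tendsto_add[OF this tendsto_const[of M]] show ?thesis by (simp add: m_def[abs_def])
  qed
  \<comment> \<open>Minimality of \<open>\<xi> k\<close>, tested with \<open>\<xi>\<^sub>d\<close>, bounds both the penalty and the residual \<open>R k\<close>.\<close>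
  define R where "R k = norm (K (Da (a k) (\<xi> k)) - vs k)" for k
  have compare: "ennreal ((R k)\<^sup>2) + ennreal (a k) * weighted_l1_norm \<Lambda> w (\<xi> k)
      \<le> ennreal (a k * m k)" for k
  proof -
    have "synthesis_functional \<Lambda> w K Da (\<alpha> (\<delta> k)) (vs k) (\<xi> k)
        \<le> synthesis_functional \<Lambda> w K Da (\<alpha> (\<delta> k)) (vs k) \<xi>\<^sub>d"
      using \<xi>[of k] \<xi>d_mem by (simp add: is_arg_min_linorder)
    also have "\<dots> = ennreal ((N k)\<^sup>2) + ennreal (a k) * ennreal M"
      by (simp add: synthesis_functional_def M N_def a_def)
    also have "\<dots> = ennreal ((N k)\<^sup>2 + a k * M)"
      using a[of k] M by (simp add: ennreal_plus ennreal_mult)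
    also have "(N k)\<^sup>2 + a k * M = a k * m k"
      using a[of k] by (simp add: m_def distrib_left)
    finally show ?thesis by (simp add: synthesis_functional_def R_def a_def)
  qed
  have \<xi>_le: "weighted_l1_norm \<Lambda> w (\<xi> k) \<le> ennreal (m k)" for k
  proof -
    have "ennreal (a k) * weighted_l1_norm \<Lambda> w (\<xi> k) \<le> ennreal (a k * m k)"
      using compare[of k] by (rule order_trans[rotated]) simp
    also have "\<dots> = ennreal (a k) * ennreal (m k)" using a[of k] m0 by (simp add: ennreal_mult)
    finally show ?thesis using a[of k] by (simp add: ennreal_mult_le_mult_iff)
  qed
  have R_le: "(R k)\<^sup>2 \<le> a k * m k" for k
  proof -
    have "ennreal ((R k)\<^sup>2) \<le> ennreal (a k * m k)"
      using compare[of k] by (rule order_trans[rotated]) simp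
    then show ?thesis using a[of k] m0[of k] by (simp add: ennreal_le_iff)
  qed
  have R0: "R \<longlonglongrightarrow> 0"
  proof -
    have "(\<lambda>k. a k * m k) \<longlonglongrightarrow> 0 * M" by (intro tendsto_mult a0 mM)
    then have bound: "(\<lambda>k. a k * m k) \<longlonglongrightarrow> 0" by simp
    have "(\<lambda>k. (R k)\<^sup>2) \<longlonglongrightarrow> 0"
      by (rule tendsto_sandwich[OF _ _ tendsto_const bound]) (use R_le in auto)
    then have "(\<lambda>k. sqrt ((R k)\<^sup>2)) \<longlonglongrightarrow> sqrt 0" by (rule tendsto_real_sqrt)
    then show ?thesis by (simp add: R_def[abs_def])
  qed
  obtain C where C: "0 < C" "\<And>k. m k \<le> C"
    using convergent_imp_Bseq[OF convergentI[OF mM]] unfolding Bseq_def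
    by (metis abs_le_D1 real_norm_def)
  have \<xi>_C: "weighted_l1_norm \<Lambda> w (\<xi> k) \<le> ennreal C" for k
    using \<xi>_le[of k] C(2)[of k] ennreal_leI order_trans by blast
  have \<xi>_bound: "ell2_norm \<Lambda> (\<xi> k) \<le> C / c" for k
    by (rule ell2_of_weighted_l1_norm_le(2)[OF c _ \<xi>_C])
       (use C \<xi>_mem[of k] in \<open>auto simp: ell2_def\<close>)
  have data: "(\<lambda>k. K (D (\<xi> k))) \<longlonglongrightarrow> v"
  proof -
    define E where "E k = norm (Da (a k) (\<xi> k) - D (\<xi> k))" for k
    have "(\<lambda>k. ennreal (E k)) \<longlonglongrightarrow> 0"
    proof (rule tendsto_sandwich[OF _ _ tendsto_const])
      show "(\<lambda>k. Delta \<Lambda> D Da (C / c) (a k)) \<longlonglongrightarrow> 0"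
        using C c(1) by (intro filterlim_compose[OF Delta0 a_right]) simp
      show "\<forall>\<^sub>F k in sequentially. ennreal (E k) \<le> Delta \<Lambda> D Da (C / c) (a k)"
        unfolding E_def using \<xi>_mem \<xi>_bound by (simp add: norm_diff_le_Delta)
    qed simp
    then have E: "E \<longlonglongrightarrow> 0"
      using tendsto_ennreal_iff[of E sequentially 0] by (simp add: E_def[abs_def])
    have le: "norm (K (D (\<xi> k)) - v) \<le> E k * B + R k + \<delta> k" for k
    proof -
      have "K (D (\<xi> k)) - v
          = K (D (\<xi> k) - Da (a k) (\<xi> k)) + (K (Da (a k) (\<xi> k)) - vs k) + (vs k - v)"
        by (simp add: K.diff)
      also have "norm \<dots> \<le> E k * B + R k + \<delta> k"
        unfolding E_def R_def norm_minus_commute[of "Da (a k) (\<xi> k)"]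
        using noise[of k] by (intro norm_triangle_mono B) (auto simp: norm_minus_commute)
      finally show ?thesis .
    qed
    have bound: "(\<lambda>k. E k * B + R k + \<delta> k) \<longlonglongrightarrow> 0"
      using tendsto_add[OF tendsto_add[OF tendsto_mult_right[OF E, of B] R0] \<delta>0]
      by (simp only: mult_zero_left add_0_right)
    have "(\<lambda>k. K (D (\<xi> k)) - v) \<longlonglongrightarrow> 0"
      by (rule Lim_null_comparison[OF _ bound]) (use le in auto)
    then show ?thesis by (rule LIM_zero_cancel)
  qed
  have limit: "minimizing_solution \<Lambda> w (K \<circ> D) v \<eta> \<and> ell2_tendsto \<Lambda> (\<xi> \<circ> r) \<eta>"
    if r: "strict_mono r" and lim: "\<And>l. l \<in> \<Lambda> \<Longrightarrow> (\<lambda>n. \<xi> (r n) l) \<longlonglongrightarrow> \<eta> l"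
      and \<eta>: "\<And>l. l \<notin> \<Lambda> \<Longrightarrow> \<eta> l = 0" for r \<eta>
  proof -
    have mr: "(\<lambda>n. m (r n)) \<longlonglongrightarrow> M" and datar: "(\<lambda>n. K (D (\<xi> (r n)))) \<longlonglongrightarrow> v"
      using LIMSEQ_subseq_LIMSEQ[OF mM r] LIMSEQ_subseq_LIMSEQ[OF data r] by (auto simp: o_def)
    note lims = minimizing_solution_limit[OF K Da_cont Delta0 c \<xi>d M(2) m0 mr \<xi>_mem \<xi>_le lim \<eta> datar]
    show ?thesis using lims by (simp add: o_def)
  qed
  have subsequence: "\<exists>s \<eta>. strict_mono s \<and> minimizing_solution \<Lambda> w (K \<circ> D) v \<eta>
      \<and> ell2_tendsto \<Lambda> (\<xi> \<circ> r \<circ> s) \<eta>" if r: "strict_mono r" for r :: "nat \<Rightarrow> nat"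
  proof -
    have "norm (\<xi> (r n) l) \<le> C / c" if "l \<in> \<Lambda>" for n l
      using norm_sum_le_of_weighted_l1_norm_le[OF c _ \<xi>_C, of "{l}" "r n"] that C by simp
    \<comment> \<open>The diagonal subsequence, as the coordinates of \<open>\<xi>\<close> are uniformly bounded.\<close>
    then obtain s :: "nat \<Rightarrow> nat" where s: "strict_mono s"
      "\<And>l. l \<in> \<Lambda> \<Longrightarrow> \<exists>b. (\<lambda>n. \<xi> (r (s n)) l) \<longlonglongrightarrow> b"
      using function_convergent_subsequence[OF countable, of "\<lambda>n. \<xi> (r n)" "C / c"] by blast
    define \<eta> where "\<eta> l = (if l \<in> \<Lambda> then lim (\<lambda>n. \<xi> (r (s n)) l) else 0)" for l
    have "(\<lambda>n. \<xi> ((r \<circ> s) n) l) \<longlonglongrightarrow> \<eta> l" if "l \<in> \<Lambda>" for l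
      using s(2)[OF that] that by (auto simp: \<eta>_def limI)
    moreover have "strict_mono (r \<circ> s)" using r s(1) by (rule strict_mono_o)
    ultimately have "minimizing_solution \<Lambda> w (K \<circ> D) v \<eta> \<and> ell2_tendsto \<Lambda> (\<xi> \<circ> (r \<circ> s)) \<eta>"
      by (intro limit) (auto simp: \<eta>_def)
    then show ?thesis using s(1) by (auto simp: o_assoc)
  qed
  show ?thesis
  proof (intro conjI allI impI)
    show "\<exists>r \<eta>. strict_mono r \<and> ell2_tendsto \<Lambda> (\<xi> \<circ> r) \<eta>"
      using subsequence[OF strict_mono_id] by auto
  next
    fix r \<eta> assume *: "strict_mono r \<and> ell2_tendsto \<Lambda> (\<xi> \<circ> r) \<eta>"
    show "minimizing_solution \<Lambda> w (K \<circ> D) v \<eta>"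
      using limit[of r \<eta>] * ell2_tendsto_pointwise[of \<Lambda> "\<xi> \<circ> r" \<eta>]
      by (auto simp: ell2_tendsto_def ell2_def)
  next
    assume unique: "\<exists>!\<eta>. minimizing_solution \<Lambda> w (K \<circ> D) v \<eta>"
    define g where "g n = ell2_norm \<Lambda> (\<lambda>l. \<xi> n l - \<xi>\<^sub>d l)" for n
    have "g \<longlonglongrightarrow> 0"
    proof (rule ccontr)
      assume "\<not> g \<longlonglongrightarrow> 0"
      then obtain e where e: "0 < e" "\<And>N. \<exists>n\<ge>N. e \<le> norm (g n)"
        unfolding LIMSEQ_iff by (auto simp: not_less)
      then have "infinite {n. e \<le> norm (g n)}"
        unfolding infinite_nat_iff_unbounded_le by blast
      then obtain r :: "nat \<Rightarrow> nat" where r: "strict_mono r" "\<And>n. e \<le> norm (g (r n))"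
        using infinite_enumerate by blast
      obtain s \<eta> where s: "minimizing_solution \<Lambda> w (K \<circ> D) v \<eta>" "ell2_tendsto \<Lambda> (\<xi> \<circ> r \<circ> s) \<eta>"
        using subsequence[OF r(1)] by blast
      have "\<eta> = \<xi>\<^sub>d" using unique s(1) \<xi>d by blast
      with s(2) have "(\<lambda>n. g (r (s n))) \<longlonglongrightarrow> 0" by (simp add: ell2_tendsto_def g_def)
      then obtain n where "norm (g (r (s n)) - 0) < e"
        using LIMSEQ_D[OF _ e(1)] by blast
      with r(2)[of "s n"] show False by simp
    qed
    then show "ell2_tendsto \<Lambda> \<xi> \<xi>\<^sub>d"
      using \<xi>_mem \<xi>d_mem by (simp add: ell2_tendsto_def g_def[abs_def])
  qed
qed

end
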